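(* Let $X$ and $Y$ be irreducible SFTs, let $\varpi:Y\to X$ be a Galois factor, and set $G=\mathrm{Gal}(Y/X,\varpi)$. Let $H$ be a subgroup of $G$, and let $(Z,\alpha,\beta)=(Z(H),\alpha(H),\beta(H))$ be the unramified intermediate factor of $\varpi$ corresponding to $H$. Then: (1) $H$ is a normal subgroup of $G$ if and only if $\beta:Z\to X$ is a Galois factor. (2) In this case, the Galois group $\mathrm{Gal}(Z/X,\beta)$ is isomorphic to the quotient group $G/H$.
   Context: A shift space over a finite alphabet $\mathcal{A}$ is a nonempty closed shift-invariant subset $X\subseteq\mathcal{A}^{\mathbb{Z}}$ (product topology), with shift map $\sigma_X$. It is a shift of finite type (SFT) if it is defined by a finite set of forbidden words, and irreducible if for all words $u,v$ occurring in points of $X$ there is a nonempty word $w$ with $uwv$ occurring in a point of $X$. A sliding block code is a continuous shift-commuting map; a factor map is a surjective one; a topological conjugacy is a bijective one; $\mathrm{Aut}(X)$ is the group of topological conjugacies $X\to X$. For irreducible SFTs $X,Y$, a factor map $\varpi:Y\to X$ is unramified if there is an integer $d\ge1$ with $|\varpi^{-1}(x)|=d$ for all $x\in X$; $\deg(\varpi)=d$. Put $\mathrm{Aut}(Y/X,\varpi)=\{\varphi\in\mathrm{Aut}(Y)\mid\varpi\circ\varphi=\varpi\}$. The map $\varpi$ is a Galois factor if it is unramified and $|\mathrm{Aut}(Y/X,\varpi)|=\deg(\varpi)$; then $\mathrm{Gal}(Y/X,\varpi):=\mathrm{Aut}(Y/X,\varpi)$. An unramified intermediate factor of an unramified factor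 map $\varpi:Y\to X$ is a triple $(Z,\alpha,\beta)$ with $Z$ an irreducible SFT, $\alpha:Y\to Z$ an unramified factor map and $\beta:Z\to X$ a sliding block code (automatically an unramified factor map) such that $\beta\circ\alpha=\varpi$. Two such triples $(Z_1,\alpha_1,\beta_1)$, $(Z_2,\alpha_2,\beta_2)$ are topologically conjugate as intermediate factors if there is a topological conjugacy $\varphi:Z_1\to Z_2$ with $\varphi\circ\alpha_1=\alpha_2$ and $\beta_1=\beta_2\circ\varphi$. For a subgroup $H\le G$, $(Z(H),\alpha(H),\beta(H))$ denotes the unramified intermediate factor (unique up to topological conjugacy of intermediate factors) such that $\alpha(H):Y\to Z(H)$ is a Galois factor with $\mathrm{Gal}(Y/Z(H),\alpha(H))=H$; concretely it is conjugate to the orbit space $Y/H$ with the quotient map $Y\to Y/H$ and the map $Y/H\to X$ induced by $\varpi$. *)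

theory Defs
  imports "HOL-Analysis.Function_Topology" "HOL-Algebra.Bij" "HOL-Algebra.Coset"
begin

text \<open>
  An alphabet is a finite type with the discrete topology, so that
  \<^typ>\<open>int \<Rightarrow> 'a\<close> carries the product topology. Sliding block codes are total functions
  of which only the values on the shift space matter.
\<close>

type_synonym 'a biseq = "int \<Rightarrow> 'a"

definition shift :: "'a biseq \<Rightarrow> 'a biseq" where
  "shift x = (\<lambda>i. x (i + 1))"

definition shift_space :: "('a::{finite,discrete_topology}) biseq set \<Rightarrow> bool" where
  "shift_space X \<longleftrightarrow> X \<noteq> {} \<and> closed X \<and> shift ` X = X"

definition occurs_in :: "'a list \<Rightarrow> 'a biseq \<Rightarrow> bool" where
  "occurs_in w x \<longleftrightarrow> (\<exists>i. \<forall>k<length w. x (i + int k) = w ! k)"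

definition language :: "'a biseq set \<Rightarrow> 'a list set" where
  "language X = {w. \<exists>x\<in>X. occurs_in w x}"

definition SFT :: "('a::{finite,discrete_topology}) biseq set \<Rightarrow> bool" where
  "SFT X \<longleftrightarrow> shift_space X \<and>
     (\<exists>F. finite F \<and> X = {x. \<forall>w\<in>F. \<not> occurs_in w x})"

definition irreducible_shift :: "'a biseq set \<Rightarrow> bool" where
  "irreducible_shift X \<longleftrightarrow>
     (\<forall>u\<in>language X. \<forall>v\<in>language X. \<exists>w. w \<noteq> [] \<and> u @ w @ v \<in> language X)"

definition irreducible_SFT :: "('a::{finite,discrete_topology}) biseq set \<Rightarrow> bool" where
  "irreducible_SFT X \<longleftrightarrow> SFT X \<and> irreducible_shift X"

definition sliding_block_code ::
  "('a::{finite,discrete_topology}) biseq set \<Rightarrow> ('b::{finite,discrete_topology}) biseq set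
     \<Rightarrow> ('a biseq \<Rightarrow> 'b biseq) \<Rightarrow> bool" where
  "sliding_block_code Y X f \<longleftrightarrow>
     f ` Y \<subseteq> X \<and> continuous_on Y f \<and> (\<forall>y\<in>Y. f (shift y) = shift (f y))"

definition factor_map ::
  "('a::{finite,discrete_topology}) biseq set \<Rightarrow> ('b::{finite,discrete_topology}) biseq set
     \<Rightarrow> ('a biseq \<Rightarrow> 'b biseq) \<Rightarrow> bool" where
  "factor_map Y X f \<longleftrightarrow> sliding_block_code Y X f \<and> f ` Y = X"

definition topological_conjugacy ::
  "('a::{finite,discrete_topology}) biseq set \<Rightarrow> ('b::{finite,discrete_topology}) biseq set
     \<Rightarrow> ('a biseq \<Rightarrow> 'b biseq) \<Rightarrow> bool" where
  "topological_conjugacy Y X f \<longleftrightarrow> sliding_block_code Y X f \<and> bij_betw f Y X"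

text \<open>
  Automorphisms are taken extensional, so that each map on \<open>X\<close> has exactly one representative
  and cardinalities of sets of automorphisms are meaningful.
\<close>

definition Aut :: "('a::{finite,discrete_topology}) biseq set \<Rightarrow> ('a biseq \<Rightarrow> 'a biseq) set" where
  "Aut X = {\<phi> \<in> extensional X. topological_conjugacy X X \<phi>}"

definition fiber ::
  "'a biseq set \<Rightarrow> ('a biseq \<Rightarrow> 'b biseq) \<Rightarrow> 'b biseq \<Rightarrow> 'a biseq set" where
  "fiber Y \<pi> x = {y \<in> Y. \<pi> y = x}"

text \<open>As \<open>d \<ge> 1\<close>, the condition on \<^const>\<open>card\<close> forces the fibers to be finite.\<close>

definition unramified ::
  "('a::{finite,discrete_topology}) biseq set \<Rightarrow> ('b::{finite,discrete_topology}) biseq set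
     \<Rightarrow> ('a biseq \<Rightarrow> 'b biseq) \<Rightarrow> bool" where
  "unramified Y X \<pi> \<longleftrightarrow> factor_map Y X \<pi> \<and> (\<exists>d\<ge>1. \<forall>x\<in>X. card (fiber Y \<pi> x) = d)"

definition factor_degree :: "'a biseq set \<Rightarrow> 'b biseq set \<Rightarrow> ('a biseq \<Rightarrow> 'b biseq) \<Rightarrow> nat" where
  "factor_degree Y X \<pi> = (THE d. \<forall>x\<in>X. card (fiber Y \<pi> x) = d)"

definition Aut_over ::
  "('a::{finite,discrete_topology}) biseq set \<Rightarrow> ('a biseq \<Rightarrow> 'b biseq)
     \<Rightarrow> ('a biseq \<Rightarrow> 'a biseq) set" where
  "Aut_over Y \<pi> = {\<phi> \<in> Aut Y. \<forall>y\<in>Y. \<pi> (\<phi> y) = \<pi> y}"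

definition galois_factor ::
  "('a::{finite,discrete_topology}) biseq set \<Rightarrow> ('b::{finite,discrete_topology}) biseq set
     \<Rightarrow> ('a biseq \<Rightarrow> 'b biseq) \<Rightarrow> bool" where
  "galois_factor Y X \<pi> \<longleftrightarrow> unramified Y X \<pi> \<and> card (Aut_over Y \<pi>) = factor_degree Y X \<pi>"

text \<open>The group structure on \<^const>\<open>Aut_over\<close>, with composition of maps on \<open>Y\<close>.\<close>

definition Gal ::
  "('a::{finite,discrete_topology}) biseq set \<Rightarrow> ('a biseq \<Rightarrow> 'b biseq)
     \<Rightarrow> ('a biseq \<Rightarrow> 'a biseq) monoid" where
  "Gal Y \<pi> = (BijGroup Y)\<lparr>carrier := Aut_over Y \<pi>\<rparr>"

definition intermediate_factor ::
  "('b::{finite,discrete_topology}) biseq set \<Rightarrow> ('a::{finite,discrete_topology}) biseq set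
     \<Rightarrow> ('b biseq \<Rightarrow> 'a biseq) \<Rightarrow> ('c::{finite,discrete_topology}) biseq set
     \<Rightarrow> ('b biseq \<Rightarrow> 'c biseq) \<Rightarrow> ('c biseq \<Rightarrow> 'a biseq) \<Rightarrow> bool" where
  "intermediate_factor Y X \<pi> Z \<alpha> \<beta> \<longleftrightarrow>
     irreducible_SFT Z \<and> unramified Y Z \<alpha> \<and> sliding_block_code Z X \<beta> \<and>
     (\<forall>y\<in>Y. \<beta> (\<alpha> y) = \<pi> y)"

text \<open>
  The triple \<open>(Z(H), \<alpha>(H), \<beta>(H))\<close> is only determined up to topological conjugacy of
  intermediate factors; the predicate holds for exactly the triples in that conjugacy class.
\<close>

definition corresponding_intermediate_factor ::
  "('b::{finite,discrete_topology}) biseq set \<Rightarrow> ('a::{finite,discrete_topology}) biseq set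
     \<Rightarrow> ('b biseq \<Rightarrow> 'a biseq) \<Rightarrow> ('b biseq \<Rightarrow> 'b biseq) set
     \<Rightarrow> ('c::{finite,discrete_topology}) biseq set
     \<Rightarrow> ('b biseq \<Rightarrow> 'c biseq) \<Rightarrow> ('c biseq \<Rightarrow> 'a biseq) \<Rightarrow> bool" where
  "corresponding_intermediate_factor Y X \<pi> H Z \<alpha> \<beta> \<longleftrightarrow>
     intermediate_factor Y X \<pi> Z \<alpha> \<beta> \<and> galois_factor Y Z \<alpha> \<and> carrier (Gal Y \<alpha>) = H"

end

(*
  The key point is rigidity: two sliding block codes from an irreducible SFT into an SFT Z that have
  the same composite with a code on Z with finite fibers agree everywhere as soon as they agree at
  one point. Hence Aut_over acts freely on the fibers of an unramified factor map, and the factor is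
  Galois iff this action is transitive. Both normality of H and the Galois property of \<beta> are
  equivalent to the condition that every element of Gal(Y/X) descends along \<alpha> to an automorphism
  of Z over X. By rigidity and transitivity every element of Gal(Z/X) arises in this way, and the
  elements descending to the identity are those of H.
*)
theory Submission
  imports Defs "HOL-Analysis.T1_Spaces"
begin

section \<open>Compactness and local rules\<close>

text \<open>Tychonoff's theorem: each coordinate space is finite and therefore compact.\<close>

lemma compact_UNIV_biseq: "compact (UNIV :: ('a::{finite,discrete_topology}) biseq set)"
proof -
  have "compact_space (product_topology (\<lambda>i::int. euclidean :: 'a topology) UNIV)"
    unfolding compact_space_product_topology
    by (auto intro: finite_imp_compactin_eq simp: compact_space_def finite_imp_compact)
  then show ?thesis
    by (simp add: euclidean_product_topology compact_space_def)
qed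

lemma shift_space_imp_compact: "shift_space Y \<Longrightarrow> compact Y"
  using closed_Int_compact[OF _ compact_UNIV_biseq, of Y] by (simp add: shift_space_def)

text \<open>A product of discrete spaces is Hausdorff, since singletons separate the points of each
  factor, and compact subsets of Hausdorff spaces are closed.\<close>

lemma compact_imp_closed_biseq:
  fixes K :: "('a::{finite,discrete_topology}) biseq set"
  assumes "compact K"
  shows "closed K"
proof -
  have "\<exists>U V. open U \<and> open V \<and> x \<in> U \<and> y \<in> V \<and> disjnt U V" if "x \<noteq> y" for x y :: 'a
    using that by (intro exI[of _ "{x}"] exI[of _ "{y}"]) (simp add: open_discrete)
  then have "Hausdorff_space (euclidean :: 'a topology)"
    by (simp add: Hausdorff_space_def)
  then have "Hausdorff_space (product_topology (\<lambda>i::int. euclidean :: 'a topology) UNIV)"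
    by (simp add: Hausdorff_space_product_topology)
  then have "Hausdorff_space (euclidean :: 'a biseq topology)"
    by (simp add: euclidean_product_topology)
  then show ?thesis
    using assms compactin_imp_closedin[of euclidean K] by simp
qed

text \<open>A continuous map from a compact space onto a Hausdorff space is closed, hence a quotient
  map. The preimage of a closed set under \<open>g\<close> is the \<open>\<alpha>\<close>-image of a
  compact subset of \<open>Y\<close>.\<close>

lemma continuous_on_descend:
  fixes \<alpha> :: "'b::topological_space \<Rightarrow> ('a::{finite,discrete_topology}) biseq"
  assumes "compact Y" "continuous_on Y \<alpha>" "continuous_on Y (\<lambda>y. g (\<alpha> y))"
  shows "continuous_on (\<alpha> ` Y) g"
  unfolding continuous_on_closed_invariant
proof (intro allI impI)
  fix B :: "'c set"
  assume "closed B"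
  then obtain A where A: "closed A" "A \<inter> Y = (\<lambda>y. g (\<alpha> y)) -` B \<inter> Y"
    using assms(3) unfolding continuous_on_closed_invariant by blast
  have "compact (A \<inter> Y)"
    using A(1) assms(1) by (rule closed_Int_compact)
  then have "compact (\<alpha> ` (A \<inter> Y))"
    by (intro compact_continuous_image continuous_on_subset[OF assms(2)]) auto
  then have "closed (\<alpha> ` (A \<inter> Y))"
    by (rule compact_imp_closed_biseq)
  moreover have "\<alpha> ` (A \<inter> Y) \<inter> \<alpha> ` Y = g -` B \<inter> \<alpha> ` Y"
    using A(2) by auto
  ultimately show "\<exists>A. closed A \<and> A \<inter> \<alpha> ` Y = g -` B \<inter> \<alpha> ` Y"
    by blast
qed

section \<open>Cylinder neighbourhoods, translations and finite coding windows\<close>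

definition cylinder :: "nat \<Rightarrow> 'a biseq \<Rightarrow> 'a biseq set" where
  "cylinder r x = {y. \<forall>k. \<bar>k\<bar> \<le> int r \<longrightarrow> y k = x k}"

lemma open_cylinder: "open (cylinder r (x :: ('a::discrete_topology) biseq))"
proof -
  have "cylinder r x = (\<Inter>k\<in>{-int r..int r}. (\<lambda>y. y k) -` {x k})"
    by (auto simp: cylinder_def abs_le_iff)
  moreover have "open ((\<lambda>y :: 'a biseq. y k) -` {x k})" for k
    by (intro open_vimage continuous_on_product_coordinates open_discrete)
  ultimately show ?thesis
    by (auto intro: open_INT)
qed

text \<open>A basic open set of the product constrains only finitely many coordinates;
  \<open>r\<close> bounds their absolute values.\<close>

lemma open_contains_cylinder:
  fixes U :: "('a::topological_space) biseq set"
  assumes "open U" "x \<in> U"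
  obtains r where "cylinder r x \<subseteq> U"
proof -
  have "openin (product_topology (\<lambda>i::int. euclidean :: 'a topology) UNIV) U"
    using assms(1) by (simp add: euclidean_product_topology)
  from product_topology_open_contains_basis[OF this assms(2)]
  obtain V where V: "x \<in> Pi\<^sub>E UNIV V" "finite {i. V i \<noteq> UNIV}" "Pi\<^sub>E UNIV V \<subseteq> U"
    by auto
  \<comment> \<open>Inserting 0 keeps \<open>Max\<close> meaningful when no coordinate is
    constrained.\<close>
  define r where "r = nat (Max (insert 0 (abs ` {i. V i \<noteq> UNIV})))"
  have "\<bar>i\<bar> \<le> int r" if "V i \<noteq> UNIV" for i
    unfolding r_def using that V(2) by (auto intro!: Max_ge simp: le_nat_iff)
  then have "cylinder r x \<subseteq> Pi\<^sub>E UNIV V"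
    using V(1) by (fastforce simp: cylinder_def PiE_iff)
  with V(3) show thesis
    using that by blast
qed

lemma shift_space_translate:
  assumes "shift_space Y" "y \<in> Y"
  shows "(\<lambda>k. y (k + n)) \<in> Y"
proof (induction n rule: int_induct[where k = 0])
  case base
  then show ?case using assms by simp
next
  case (step1 n)
  then have "shift (\<lambda>k. y (k + n)) \<in> Y"
    using assms(1) by (auto simp: shift_space_def)
  then show ?case
    by (simp add: shift_def algebra_simps)
next
  case (step2 n)
  \<comment> \<open>Translating backwards uses surjectivity of \<open>shift\<close> on
    \<open>Y\<close>; injectivity of \<open>shift\<close> identifies the preimage found.\<close>
  then obtain y' where y': "y' \<in> Y" "shift y' = (\<lambda>k. y (k + n))"
    using assms(1) unfolding shift_space_def by (metis imageE)
  have "y' = (\<lambda>k. y (k + (n - 1)))"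
  proof
    fix k
    show "y' k = y (k + (n - 1))"
      using fun_cong[OF y'(2), of "k - 1"] by (simp add: shift_def algebra_simps)
  qed
  with y'(1) show ?case by simp
qed

lemma sliding_block_code_translate:
  assumes "shift_space Y" "sliding_block_code Y Z f" "y \<in> Y"
  shows "f (\<lambda>k. y (k + n)) = (\<lambda>k. f y (k + n))"
proof (induction n rule: int_induct[where k = 0])
  case base
  then show ?case by simp
next
  case (step1 n)
  have "f (shift (\<lambda>k. y (k + n))) = shift (f (\<lambda>k. y (k + n)))"
    using assms shift_space_translate[OF assms(1,3), of n] by (simp add: sliding_block_code_def)
  with step1 show ?case
    by (simp add: shift_def algebra_simps)
next
  case (step2 n)
  have "f (shift (\<lambda>k. y (k + (n - 1)))) = shift (f (\<lambda>k. y (k + (n - 1))))"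
    using assms shift_space_translate[OF assms(1,3), of "n - 1"] by (simp add: sliding_block_code_def)
  then have eq: "(\<lambda>k. f y (k + n)) = shift (f (\<lambda>k. y (k + (n - 1))))"
    using step2 by (simp add: shift_def algebra_simps)
  show ?case
  proof
    fix k
    show "f (\<lambda>k. y (k + (n - 1))) k = f y (k + (n - 1))"
      using fun_cong[OF eq, of "k - 1"] by (simp add: shift_def algebra_simps)
  qed
qed

text \<open>One direction of the Curtis-Hedlund-Lyndon theorem. As the alphabet is discrete,
  coordinate 0 of \<open>f\<close> is constant on a cylinder around each point. Finitely many of
  these cover \<open>Y\<close> by compactness, the largest radius serves all of them, and
  translation moves the rule to every coordinate.\<close>

lemma sliding_block_code_local:
  fixes f :: "('a::{finite,discrete_topology}) biseq \<Rightarrow> ('b::{finite,discrete_topology}) biseq"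
  assumes "shift_space Y" "sliding_block_code Y Z f"
  obtains r :: nat where
    "\<And>y y' i. y \<in> Y \<Longrightarrow> y' \<in> Y \<Longrightarrow> (\<And>k. \<bar>k - i\<bar> \<le> int r \<Longrightarrow> y k = y' k) \<Longrightarrow> f y i = f y' i"
proof -
  have "continuous_on Y (\<lambda>y. f y 0)"
    using assms(2) continuous_on_product_then_coordinatewise
    by (auto simp: sliding_block_code_def)
  have ex: "\<exists>r. \<forall>y'\<in>Y \<inter> cylinder r y. f y' 0 = f y 0" if "y \<in> Y" for y
  proof -
    obtain U where U: "open U" "U \<inter> Y = (\<lambda>y. f y 0) -` {f y 0} \<inter> Y"
      using \<open>continuous_on Y (\<lambda>y. f y 0)\<close> open_discrete[of "{f y 0}"]
      unfolding continuous_on_open_invariant by blast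
    with that have "y \<in> U" by auto
    with U(1) obtain r where "cylinder r y \<subseteq> U"
      by (rule open_contains_cylinder)
    with U(2) show ?thesis by blast
  qed
  then obtain \<rho> where \<rho>: "\<And>y y'. y \<in> Y \<Longrightarrow> y' \<in> Y \<Longrightarrow> y' \<in> cylinder (\<rho> y) y \<Longrightarrow> f y' 0 = f y 0"
    by (metis Int_iff)
  have "Y \<subseteq> (\<Union>y\<in>Y. cylinder (\<rho> y) y)"
    by (auto simp: cylinder_def)
  then obtain C where C: "C \<subseteq> Y" "finite C" "Y \<subseteq> (\<Union>y\<in>C. cylinder (\<rho> y) y)"
    by (rule compactE_image[OF shift_space_imp_compact[OF assms(1)] open_cylinder])
  define r where "r = Max (\<rho> ` C)"
  have zero: "f y 0 = f y' 0" if "y \<in> Y" "y' \<in> Y" "\<And>k. \<bar>k\<bar> \<le> int r \<Longrightarrow> y k = y' k" for y y'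
  proof -
    obtain c where c: "c \<in> C" "y \<in> cylinder (\<rho> c) c"
      using C(3) \<open>y \<in> Y\<close> by blast
    have "\<rho> c \<le> r"
      using c(1) C(2) by (simp add: r_def)
    then have "y' \<in> cylinder (\<rho> c) c"
      using c(2) that(3) by (auto simp: cylinder_def)
    then have "f y' 0 = f c 0"
      using \<rho>[of c y'] c(1) C(1) that(2) by blast
    moreover have "f y 0 = f c 0"
      using \<rho>[of c y] c C(1) that(1) by blast
    ultimately show ?thesis by simp
  qed
  have "f y i = f y' i"
    if "y \<in> Y" "y' \<in> Y" "\<And>k. \<bar>k - i\<bar> \<le> int r \<Longrightarrow> y k = y' k" for y y' i
  proof -
    have "f (\<lambda>k. y (k + i)) 0 = f (\<lambda>k. y' (k + i)) 0"
      using that by (intro zero shift_space_translate[OF assms(1)]) auto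
    then show ?thesis
      by (simp add: sliding_block_code_translate[OF assms] that)
  qed
  then show thesis by (rule that)
qed

section \<open>Splicing in shifts of finite type\<close>

text \<open>Forbidden words have bounded length, so any occurrence fits into one window, where
  \<open>x\<close> coincides with a point that avoids the word. The 0 in the definition of
  \<open>m\<close> covers an empty set of forbidden words.\<close>

lemma SFT_local:
  assumes "SFT Z"
  obtains m :: nat where
    "\<And>x. (\<And>i. \<exists>z\<in>Z. \<forall>k. i \<le> k \<and> k \<le> i + int m \<longrightarrow> x k = z k) \<Longrightarrow> x \<in> Z"
proof -
  obtain F where F: "finite F" "Z = {x. \<forall>w\<in>F. \<not> occurs_in w x}"
    using assms by (auto simp: SFT_def)
  define m where "m = Max (insert 0 (length ` F))"
  have "x \<in> Z" if x: "\<And>i. \<exists>z\<in>Z. \<forall>k. i \<le> k \<and> k \<le> i + int m \<longrightarrow> x k = z k" for x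
  proof (rule ccontr)
    assume "x \<notin> Z"
    then obtain w i where w: "w \<in> F" "\<And>k. k < length w \<Longrightarrow> x (i + int k) = w ! k"
      using F(2) by (auto simp: occurs_in_def)
    obtain z where z: "z \<in> Z" "\<And>k. i \<le> k \<Longrightarrow> k \<le> i + int m \<Longrightarrow> x k = z k"
      using x by blast
    have "length w \<le> m"
      using w(1) F(1) by (auto simp: m_def intro!: Max_ge)
    then have "z (i + int k) = w ! k" if "k < length w" for k
      using w(2)[OF that] z(2)[of "i + int k"] that by simp
    then have "occurs_in w z"
      by (auto simp: occurs_in_def)
    with z(1) w(1) F(2) show False by blast
  qed
  then show thesis by (rule that)
qed

text \<open>The interval is half-open so that successive period blocks are disjoint; distinct blocks
  then yield distinct splices.\<close>

definition splice :: "int \<Rightarrow> int \<Rightarrow> 'a biseq \<Rightarrow> 'a biseq \<Rightarrow> 'a biseq" where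
  "splice a b p q = (\<lambda>i. if a \<le> i \<and> i < b then q i else p i)"

text \<open>A window inside the block enlarged by \<open>R\<close> leaves the block only where
  \<open>p\<close> and \<open>q\<close> agree, so it reads \<open>q\<close>. Any other window is too
  short to meet the block and reads \<open>p\<close>.\<close>

lemma splice_window:
  assumes "\<And>k. \<bar>k - a\<bar> \<le> R \<Longrightarrow> p k = q k" "\<And>k. \<bar>k - b\<bar> \<le> R \<Longrightarrow> p k = q k" "j - i \<le> R"
  shows "(\<forall>k. i \<le> k \<and> k \<le> j \<longrightarrow> splice a b p q k = p k) \<or>
         (\<forall>k. i \<le> k \<and> k \<le> j \<longrightarrow> splice a b p q k = q k)"
proof (cases "a - R \<le> i \<and> j \<le> b + R")
  case True
  have "splice a b p q k = q k" if "i \<le> k" "k \<le> j" for k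
    using assms(1)[of k] assms(2)[of k] assms(3) that True by (auto simp: splice_def)
  then show ?thesis by blast
next
  case False
  have "splice a b p q k = p k" if "i \<le> k" "k \<le> j" for k
    using assms(3) that False by (auto simp: splice_def)
  then show ?thesis by blast
qed

text \<open>Irreducibility yields a point containing \<open>u @ a @ v @ b @ u\<close>, with
  \<open>u\<close> and \<open>v\<close> central words of the two given points. Repeating
  \<open>u @ a @ v @ b\<close> stays in \<open>Y\<close> because the overlap \<open>u\<close> is
  long enough to hide the seams from windows of length \<open>m + 1\<close>.\<close>

lemma SFT_periodic_point:
  assumes "irreducible_SFT Y" "y\<^sub>1 \<in> Y" "y\<^sub>2 \<in> Y"
  obtains Q P c where "Q \<in> Y" "P > (0::int)" "\<And>k. Q (k + P) = Q k"
    "Q \<in> cylinder L y\<^sub>1" "(\<lambda>k. Q (k + c)) \<in> cylinder L y\<^sub>2"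
proof -
  have ss: "shift_space Y"
    using assms(1) by (simp add: irreducible_SFT_def SFT_def)
  obtain m where m: "\<And>x. (\<And>i. \<exists>z\<in>Y. \<forall>k. i \<le> k \<and> k \<le> i + int m \<longrightarrow> x k = z k) \<Longrightarrow> x \<in> Y"
    using SFT_local[of Y] assms(1) by (auto simp: irreducible_SFT_def)
  \<comment> \<open>\<open>M \<ge> L\<close> makes the words long enough for shadowing, and
    \<open>M \<ge> m\<close> makes \<open>u\<close> long enough to bridge a seam.\<close>
  define M where "M = max L m"
  define word where "word y = map (\<lambda>k. y (int k - int M)) [0..<2 * M + 1]" for y :: "'a biseq"
  have len: "length (word y) = 2 * M + 1" for y
    by (simp add: word_def)
  have nth: "word y ! k = y (int k - int M)" if "k < 2 * M + 1" for y k
    using that by (simp add: word_def del: upt_Suc)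
  have lang: "word y \<in> language Y" if "y \<in> Y" for y
    using that len nth unfolding language_def occurs_in_def
    by (intro CollectI bexI[of _ y] exI[of _ "- int M"]) (auto simp: algebra_simps)
  define u v where "u = word y\<^sub>1" and "v = word y\<^sub>2"
  have irr: "\<And>s t. s \<in> language Y \<Longrightarrow> t \<in> language Y \<Longrightarrow> \<exists>w. s @ w @ t \<in> language Y"
    using assms(1) by (auto simp: irreducible_SFT_def irreducible_shift_def)
  obtain a where a: "u @ a @ v \<in> language Y"
    using irr lang assms(2,3) unfolding u_def v_def by blast
  obtain b where "(u @ a @ v) @ b @ u \<in> language Y"
    using irr[OF a lang[OF assms(2)]] unfolding u_def by blast
  then obtain z i where z: "z \<in> Y"
    and zi: "\<And>k. k < length ((u @ a @ v) @ b @ u) \<Longrightarrow> z (i + int k) = ((u @ a @ v) @ b @ u) ! k"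
    by (auto simp: language_def occurs_in_def)
  define N where "N = length (u @ a @ v @ b)"
  define P where "P = int N"
  have Ppos: "P > 0" by (simp add: P_def N_def u_def len)
  have z1: "z (i + int k) = u ! k" if "k < length u" for k
    using zi[of k] that by (simp add: nth_append)
  have z2: "z (i + P + int k) = u ! k" if "k < length u" for k
    using zi[of "N + k"] that by (simp add: nth_append N_def P_def algebra_simps)
  have z3: "z (i + int (length u + length a) + int k) = v ! k" if "k < length v" for k
    using zi[of "length u + length a + k"] that by (simp add: nth_append algebra_simps)
  \<comment> \<open>The offset \<open>M\<close> places the centre of \<open>u\<close> at coordinate
    0.\<close>
  define Q where "Q k = z (i + (k + int M) mod P)" for k
  have "Q \<in> Y"
  proof (rule m)
    fix j
    define t where "t = (j + int M) mod P"
    have t: "0 \<le> t" "t < P"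
      using Ppos by (auto simp: t_def)
    \<comment> \<open>Each window is read off one translate of \<open>z\<close>. If it runs past the
      end of a period, the index wraps into the first copy of \<open>u\<close>, and the second copy
      at \<open>i + P\<close> provides the same letters without a break.\<close>
    have "Q k = z (k + (i + t - j))" if k: "j \<le> k" "k \<le> j + int m" for k
    proof (cases "t + (k - j) < P")
      case True
      have "(k + int M) mod P = (t + (k - j)) mod P"
        using mod_add_left_eq[of "j + int M" P "k - j"] by (simp add: t_def add.commute)
      also have "\<dots> = t + (k - j)"
        using True t(1) k(1) by (intro mod_pos_pos_trivial) auto
      finally have "Q k = z (i + (t + (k - j)))"
        by (simp only: Q_def)
      also have "i + (t + (k - j)) = k + (i + t - j)"
        by simp
      finally show ?thesis .
    next
      case False
      define e where "e = nat (t + (k - j) - P)"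
      have e: "int e = t + (k - j) - P"
        using False by (simp add: e_def)
      have lt: "e < length u"
        using e t(2) k(2) by (simp add: u_def len M_def)
      have "length u \<le> N" by (simp add: N_def)
      then have eP: "int e < P" using lt by (simp add: P_def)
      have "(k + int M) mod P = (t + (k - j)) mod P"
        using mod_add_left_eq[of "j + int M" P "k - j"] by (simp add: t_def add.commute)
      also have "\<dots> = (int e + P) mod P"
        using e by simp
      also have "\<dots> = int e"
        using eP by simp
      finally have "Q k = u ! e"
        using z1[OF lt] by (simp add: Q_def)
      also have "\<dots> = z (i + P + int e)"
        using z2[OF lt] by simp
      also have "i + P + int e = k + (i + t - j)"
        using e by simp
      finally show ?thesis .
    qed
    then show "\<exists>z\<in>Y. \<forall>k. j \<le> k \<and> k \<le> j + int m \<longrightarrow> Q k = z k"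
      by (intro bexI[OF _ shift_space_translate[OF ss z, of "i + t - j"]]) simp
  qed
  moreover have "Q (k + P) = Q k" for k
  proof -
    have "(k + P + int M) mod P = (k + int M) mod P"
      using mod_add_self2[of "k + int M" P] by (simp add: ac_simps)
    then show ?thesis by (simp add: Q_def)
  qed
  moreover have "Q k = y\<^sub>1 k" if "\<bar>k\<bar> \<le> int L" for k
  proof -
    define e where "e = nat (k + int M)"
    have e: "int e = k + int M" "e < 2 * M + 1"
      using that by (auto simp: e_def M_def)
    have "e < N"
      using e(2) by (simp add: N_def u_def len)
    then have "Q k = z (i + int e)"
      by (simp add: Q_def P_def flip: e(1))
    also have "\<dots> = y\<^sub>1 k"
      using z1[of e] e by (simp add: u_def len nth)
    finally show ?thesis .
  qed
  \<comment> \<open>The centres of \<open>u\<close> and \<open>v\<close> are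
    \<open>length u + length a\<close> apart, since the two words have equal length.\<close>
  moreover have "Q (k + int (length u + length a)) = y\<^sub>2 k" if "\<bar>k\<bar> \<le> int L" for k
  proof -
    define e where "e = nat (k + int M)"
    have e: "int e = k + int M" "e < 2 * M + 1"
      using that by (auto simp: e_def M_def)
    define n where "n = length u + length a + e"
    have "n < N"
      using e(2) by (simp add: n_def N_def v_def len)
    have "k + int (length u + length a) + int M = int n"
      using e(1) by (simp add: n_def)
    then have "Q (k + int (length u + length a)) = z (i + int n mod P)"
      by (simp only: Q_def)
    also have "int n mod P = int n"
      using \<open>n < N\<close> by (simp add: P_def)
    also have "i + int n = i + int (length u + length a) + int e"
      by (simp add: n_def)
    also have "z (i + int (length u + length a) + int e) = y\<^sub>2 k"
      using z3[of e] e by (simp add: v_def len nth)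
    finally show ?thesis .
  qed
  ultimately show thesis
    using Ppos by (intro that[of Q P "int (length u + length a)"]) (simp_all add: cylinder_def)
qed

text \<open>
  If \<open>f \<noteq> f'\<close>, a periodic point \<open>Q\<close> shadowing both a coincidence and a difference of \<open>f\<close> and
  \<open>f'\<close> gives two points \<open>f Q \<noteq> f' Q\<close> with the same image under \<open>\<beta>\<close> that agree on long
  windows once per period. Exchanging \<open>f Q\<close> for \<open>f' Q\<close> on a single period yields infinitely
  many points in one fiber of \<open>\<beta>\<close>.
\<close>

lemma sliding_block_code_lift_unique:
  assumes "irreducible_SFT Y" "SFT Z"
    and f: "sliding_block_code Y Z f" and f': "sliding_block_code Y Z f'"
    and \<beta>: "sliding_block_code Z X \<beta>" and fin: "\<And>x. finite (fiber Z \<beta> x)"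
    and lift: "\<And>y. y \<in> Y \<Longrightarrow> \<beta> (f y) = \<beta> (f' y)"
    and y\<^sub>1: "y\<^sub>1 \<in> Y" "f y\<^sub>1 = f' y\<^sub>1"
    and "y \<in> Y"
  shows "f y = f' y"
proof (rule ccontr)
  assume "f y \<noteq> f' y"
  then obtain i\<^sub>0 where i\<^sub>0: "f y i\<^sub>0 \<noteq> f' y i\<^sub>0" by blast
  have ssY: "shift_space Y" and ssZ: "shift_space Z"
    using assms(1,2) by (auto simp: irreducible_SFT_def SFT_def)
  obtain r where r: "\<And>y y' i. y \<in> Y \<Longrightarrow> y' \<in> Y \<Longrightarrow>
      (\<And>k. \<bar>k - i\<bar> \<le> int r \<Longrightarrow> y k = y' k) \<Longrightarrow> f y i = f y' i"
    using sliding_block_code_local[OF ssY f] by blast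
  obtain r' where r': "\<And>y y' i. y \<in> Y \<Longrightarrow> y' \<in> Y \<Longrightarrow>
      (\<And>k. \<bar>k - i\<bar> \<le> int r' \<Longrightarrow> y k = y' k) \<Longrightarrow> f' y i = f' y' i"
    using sliding_block_code_local[OF ssY f'] by blast
  obtain s where s: "\<And>y y' i. y \<in> Z \<Longrightarrow> y' \<in> Z \<Longrightarrow>
      (\<And>k. \<bar>k - i\<bar> \<le> int s \<Longrightarrow> y k = y' k) \<Longrightarrow> \<beta> y i = \<beta> y' i"
    using sliding_block_code_local[OF ssZ \<beta>] by blast
  obtain m where m: "\<And>x. (\<And>i. \<exists>z\<in>Z. \<forall>k. i \<le> k \<and> k \<le> i + int m \<longrightarrow> x k = z k) \<Longrightarrow> x \<in> Z"
    using SFT_local[OF assms(2)] by blast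
  \<comment> \<open>This width accommodates both the windows of the SFT condition on
    \<open>Z\<close> and the coding windows of \<open>\<beta>\<close>.\<close>
  define R where "R = m + 2 * s"
  \<comment> \<open>Adding the coding radii lets agreement of points of \<open>Y\<close> on the
    window of radius \<open>L\<close> control the images under \<open>f\<close> and
    \<open>f'\<close> up to distance \<open>R\<close>, and also at \<open>i\<^sub>0\<close>.\<close>
  define L where "L = R + r + r' + nat \<bar>i\<^sub>0\<bar>"
  obtain Q P c where Q: "Q \<in> Y" "P > 0" "\<And>k. Q (k + P) = Q k"
    "Q \<in> cylinder L y\<^sub>1" "(\<lambda>k. Q (k + c)) \<in> cylinder L y"
    using SFT_periodic_point[OF assms(1) y\<^sub>1(1) \<open>y \<in> Y\<close>, of L] by metis
  define p q where "p = f Q" and "q = f' Q"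
  have pqZ: "p \<in> Z" "q \<in> Z" and \<beta>pq: "\<beta> p = \<beta> q"
    using f f' Q(1) lift by (auto simp: p_def q_def sliding_block_code_def)
  have "(\<lambda>k. Q (k + P)) = Q" using Q(3) by blast
  then have "p (k + P) = p k" "q (k + P) = q k" for k
    using fun_cong[OF sliding_block_code_translate[OF ssY f Q(1), of P], of k]
      fun_cong[OF sliding_block_code_translate[OF ssY f' Q(1), of P], of k]
    by (simp_all add: p_def q_def)
  then have per: "p (k + n * P) = p k \<and> q (k + n * P) = q k" for k n
  proof (induction n rule: int_induct[where k = 0])
    case (step1 n)
    then show ?case by (metis add.assoc distrib_right mult_1)
  next
    case (step2 n)
    have "k + n * P = (k + (n - 1) * P) + P" by (simp add: algebra_simps)
    with step2 show ?case by metis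
  qed simp
  have agree0: "p k = q k" if "\<bar>k\<bar> \<le> int R" for k
  proof -
    have "p k = f y\<^sub>1 k" unfolding p_def
      using Q(4) that by (intro r Q(1) y\<^sub>1(1)) (auto simp: cylinder_def L_def)
    moreover have "q k = f' y\<^sub>1 k" unfolding q_def
      using Q(4) that by (intro r' Q(1) y\<^sub>1(1)) (auto simp: cylinder_def L_def)
    ultimately show ?thesis using y\<^sub>1(2) by simp
  qed
  have agree: "p k = q k" if "\<bar>k - n * P\<bar> \<le> int R" for k n
    using agree0[OF that] per[of "k - n * P" n] by simp
  have differ: "p (i\<^sub>0 + c) \<noteq> q (i\<^sub>0 + c)"
  proof -
    have Qc: "(\<lambda>k. Q (k + c)) \<in> Y"
      using shift_space_translate[OF ssY Q(1)] .
    have "p (i\<^sub>0 + c) = f (\<lambda>k. Q (k + c)) i\<^sub>0"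
      by (simp add: p_def sliding_block_code_translate[OF ssY f Q(1)])
    also have "\<dots> = f y i\<^sub>0"
      using Q(5) by (intro r Qc \<open>y \<in> Y\<close>) (auto simp: cylinder_def L_def)
    finally have 1: "p (i\<^sub>0 + c) = f y i\<^sub>0" .
    have "q (i\<^sub>0 + c) = f' (\<lambda>k. Q (k + c)) i\<^sub>0"
      by (simp add: q_def sliding_block_code_translate[OF ssY f' Q(1)])
    also have "\<dots> = f' y i\<^sub>0"
      using Q(5) by (intro r' Qc \<open>y \<in> Y\<close>) (auto simp: cylinder_def L_def)
    finally show ?thesis using 1 i\<^sub>0 by simp
  qed
  \<comment> \<open>By periodicity the difference between \<open>p\<close> and \<open>q\<close>
    recurs in every block, at the same position \<open>j\<close> within the block.\<close>
  define j where "j = (i\<^sub>0 + c) mod P"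
  have j: "0 \<le> j" "j < P" "p j \<noteq> q j"
    using Q(2) differ per[of j "(i\<^sub>0 + c) div P"] by (auto simp: j_def)
  define S where "S n = splice (n * P) ((n + 1) * P) p q" for n
  have window: "(\<forall>k. a \<le> k \<and> k \<le> b \<longrightarrow> S n k = p k) \<or> (\<forall>k. a \<le> k \<and> k \<le> b \<longrightarrow> S n k = q k)"
    if "b - a \<le> int R" for a b n
    unfolding S_def using agree that by (intro splice_window[where R = "int R"]) auto
  have SZ: "S n \<in> Z" for n
  proof (rule m)
    fix i
    show "\<exists>z\<in>Z. \<forall>k. i \<le> k \<and> k \<le> i + int m \<longrightarrow> S n k = z k"
      using window[of "i + int m" i n] pqZ by (auto simp: R_def)
  qed
  \<comment> \<open>Every coding window of \<open>S n\<close> is a window of \<open>p\<close> or of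
    \<open>q\<close>, and these two points have the same image.\<close>
  have "\<beta> (S n) = \<beta> p" for n
  proof
    fix i
    have "\<beta> (S n) i = \<beta> p i \<or> \<beta> (S n) i = \<beta> q i"
      using window[of "i + int s" "i - int s" n] s[OF SZ pqZ(1), of i n] s[OF SZ pqZ(2), of i n]
      by (auto simp: R_def abs_le_iff)
    then show "\<beta> (S n) i = \<beta> p i" using \<beta>pq by simp
  qed
  then have "range S \<subseteq> fiber Z \<beta> (\<beta> p)"
    using SZ by (auto simp: fiber_def)
  moreover have "inj S"
  proof (rule injI)
    fix n n' :: int
    assume eq: "S n = S n'"
    \<comment> \<open>At this coordinate \<open>S n\<close> shows \<open>q\<close>, which differs
      from \<open>p\<close>. Hence the coordinate also lies in the block of \<open>S n'\<close>, and
      disjointness forces \<open>n = n'\<close>.\<close>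
    have "S n (j + n * P) \<noteq> p (j + n * P)"
      using j per[of j n] by (auto simp: S_def splice_def algebra_simps)
    then have "S n' (j + n * P) \<noteq> p (j + n * P)"
      using eq by simp
    then have "n' * P \<le> j + n * P" "j + n * P < (n' + 1) * P"
      by (auto simp: S_def splice_def split: if_splits)
    then have "n' * P < (n + 1) * P" "n * P < (n' + 1) * P"
      using j(1,2) by (auto simp: algebra_simps)
    then have "n' < n + 1" "n < n' + 1"
      using Q(2) by (simp_all only: mult_less_cancel_right_disj) auto
    then show "n = n'" by simp
  qed
  ultimately show False
    using fin[of "\<beta> p"] finite_subset infinite_UNIV_int finite_imageD by metis
qed

section \<open>Automorphisms over a factor\<close>

lemma Aut_overD:
  assumes "g \<in> Aut_over Y \<pi>"
  shows "g \<in> extensional Y" "sliding_block_code Y Y g" "bij_betw g Y Y"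
    "\<And>y. y \<in> Y \<Longrightarrow> g y \<in> Y" "\<And>y. y \<in> Y \<Longrightarrow> \<pi> (g y) = \<pi> y"
  using assms by (auto simp: Aut_over_def Aut_def topological_conjugacy_def bij_betw_def)

lemma Aut_overI:
  assumes "g \<in> extensional Y" "sliding_block_code Y Y g" "bij_betw g Y Y"
    "\<And>y. y \<in> Y \<Longrightarrow> \<pi> (g y) = \<pi> y"
  shows "g \<in> Aut_over Y \<pi>"
  using assms by (auto simp: Aut_over_def Aut_def topological_conjugacy_def)

section \<open>Composition and descent of sliding block codes\<close>

lemma sliding_block_code_comp:
  assumes "sliding_block_code Y Z f" "sliding_block_code Z W g"
  shows "sliding_block_code Y W (\<lambda>y. g (f y))"
proof -
  have "f ` Y \<subseteq> Z" "g ` Z \<subseteq> W" "continuous_on Y f" "continuous_on Z g"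
    using assms by (auto simp: sliding_block_code_def)
  then have "continuous_on Y (\<lambda>y. g (f y))"
    by (intro continuous_on_compose2[of Z g Y f])
  moreover have "g (f (shift y)) = shift (g (f y))" if "y \<in> Y" for y
    using assms that \<open>f ` Y \<subseteq> Z\<close> by (auto simp: sliding_block_code_def)
  ultimately show ?thesis
    using \<open>f ` Y \<subseteq> Z\<close> \<open>g ` Z \<subseteq> W\<close> by (auto simp: sliding_block_code_def)
qed

lemma sliding_block_code_cong:
  assumes "sliding_block_code Y Z f" "\<And>y. y \<in> Y \<Longrightarrow> g y = f y" "shift ` Y \<subseteq> Y"
  shows "sliding_block_code Y Z g"
proof -
  have "continuous_on Y g"
    using assms(1,2) continuous_on_cong[of Y Y g f] by (simp add: sliding_block_code_def)
  moreover have "g ` Y = f ` Y"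
    using assms(2) by (rule image_cong[OF refl])
  moreover have "shift y \<in> Y" if "y \<in> Y" for y
    using assms(3) that by blast
  ultimately show ?thesis
    using assms(1,2) by (simp add: sliding_block_code_def)
qed

text \<open>The quotient property of \<open>\<alpha>\<close>: continuity descends by compactness,
  and commutation with the shift is checked on representatives in \<open>Y\<close>.\<close>

lemma sliding_block_code_descend:
  assumes "shift_space Y" "sliding_block_code Y Z \<alpha>" "\<alpha> ` Y = Z"
    and "sliding_block_code Y W (\<lambda>y. g (\<alpha> y))"
  shows "sliding_block_code Z W g"
proof -
  have "continuous_on (\<alpha> ` Y) g"
    using assms by (intro continuous_on_descend shift_space_imp_compact)
      (auto simp: sliding_block_code_def)
  moreover have "g (shift (\<alpha> y)) = shift (g (\<alpha> y))" if "y \<in> Y" for y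
    using assms(2,4) that by (simp add: sliding_block_code_def)
  ultimately show ?thesis
    using assms(3,4) by (auto simp: sliding_block_code_def)
qed

lemma subgroup_Aut_over:
  assumes "shift_space Y"
  shows "subgroup (Aut_over Y \<pi>) (BijGroup Y)"
proof -
  interpret group "BijGroup Y" by (rule group_BijGroup)
  have shift: "shift ` Y \<subseteq> Y"
    using assms by (simp add: shift_space_def)
  have Bij: "Aut_over Y \<pi> \<subseteq> Bij Y"
    using Aut_overD by (fastforce simp: Bij_def)
  have id: "sliding_block_code Y Y (\<lambda>y. y)"
    using shift by (auto simp: sliding_block_code_def)
  show ?thesis
  proof (rule subgroupI)
    show "Aut_over Y \<pi> \<subseteq> carrier (BijGroup Y)"
      using Bij by (simp add: BijGroup_def)
    have "(\<lambda>y\<in>Y. y) \<in> Aut_over Y \<pi>"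
      by (intro Aut_overI sliding_block_code_cong[OF id _ shift]) (auto simp: bij_betw_def inj_on_def)
    then show "Aut_over Y \<pi> \<noteq> {}" by blast
  next
    fix g assume g: "g \<in> Aut_over Y \<pi>"
    note gD = Aut_overD[OF g]
    let ?h = "\<lambda>y\<in>Y. inv_into Y g y"
    have img: "g ` Y = Y" and inj: "inj_on g Y"
      using gD(3) by (auto simp: bij_betw_def)
    have left: "?h (g y) = y" if "y \<in> Y" for y
      using that inj gD(4) by simp
    \<comment> \<open>The inverse is a block code by descent along \<open>g\<close> itself: its
      composite with \<open>g\<close> is the identity on \<open>Y\<close>.\<close>
    have "sliding_block_code Y Y (\<lambda>y. ?h (g y))"
      by (rule sliding_block_code_cong[OF id _ shift]) (rule left)
    then have "sliding_block_code Y Y ?h"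
      by (rule sliding_block_code_descend[where g = ?h, OF assms gD(2) img])
    moreover have "bij_betw ?h Y Y"
      using bij_betw_inv_into[OF gD(3)] by simp
    moreover have "\<pi> (?h y) = \<pi> y" if "y \<in> Y" for y
      using that gD(5)[of "inv_into Y g y"] img by (simp add: inv_into_into f_inv_into_f)
    ultimately have "?h \<in> Aut_over Y \<pi>"
      by (intro Aut_overI) auto
    then show "inv\<^bsub>BijGroup Y\<^esub> g \<in> Aut_over Y \<pi>"
      using g Bij by (auto simp: inv_BijGroup)
  next
    fix g h assume g: "g \<in> Aut_over Y \<pi>" and h: "h \<in> Aut_over Y \<pi>"
    note gD = Aut_overD[OF g] and hD = Aut_overD[OF h]
    have "compose Y g h \<in> Aut_over Y \<pi>"
    proof (rule Aut_overI)
      show "sliding_block_code Y Y (compose Y g h)"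
        by (rule sliding_block_code_cong[OF sliding_block_code_comp[OF hD(2) gD(2)] _ shift])
          (simp add: compose_def)
      show "bij_betw (compose Y g h) Y Y"
        using hD(3) gD(3) by (rule bij_betw_compose)
    qed (auto simp: compose_def gD hD)
    then show "g \<otimes>\<^bsub>BijGroup Y\<^esub> h \<in> Aut_over Y \<pi>"
      using g h Bij by (auto simp: BijGroup_def)
  qed
qed

lemma carrier_Gal [simp]: "carrier (Gal Y \<pi>) = Aut_over Y \<pi>"
  by (simp add: Gal_def)

lemma group_Gal: "shift_space Y \<Longrightarrow> group (Gal Y \<pi>)"
  unfolding Gal_def by (intro subgroup.subgroup_is_group subgroup_Aut_over group_BijGroup)

lemma Gal_mult:
  assumes "g \<in> Aut_over Y \<pi>" "h \<in> Aut_over Y \<pi>"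
  shows "g \<otimes>\<^bsub>Gal Y \<pi>\<^esub> h = compose Y g h"
  using Aut_overD[OF assms(1)] Aut_overD[OF assms(2)]
  by (simp add: Gal_def BijGroup_def Bij_def)

lemma Gal_one: "\<one>\<^bsub>Gal Y \<pi>\<^esub> = (\<lambda>y\<in>Y. y)"
  by (simp add: Gal_def BijGroup_def)

section \<open>Fibers of unramified maps and the action of automorphisms on them\<close>

lemma unramified_finite_fiber:
  assumes "unramified Y X \<pi>"
  shows "finite (fiber Y \<pi> x)"
proof (cases "x \<in> X")
  case True
  then have "card (fiber Y \<pi> x) \<ge> 1"
    using assms by (auto simp: unramified_def)
  then show ?thesis by (auto intro: card_ge_0_finite)
next
  case False
  then have "fiber Y \<pi> x = {}"
    using assms by (auto simp: fiber_def unramified_def factor_map_def)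
  then show ?thesis by simp
qed

lemma unramified_card_fiber:
  assumes "unramified Y X \<pi>" "x \<in> X"
  shows "card (fiber Y \<pi> x) = factor_degree Y X \<pi>"
proof -
  obtain d where d: "\<forall>x\<in>X. card (fiber Y \<pi> x) = d"
    using assms(1) by (auto simp: unramified_def)
  then have "factor_degree Y X \<pi> = d"
    unfolding factor_degree_def using assms(2) by (intro the_equality) auto
  with d assms(2) show ?thesis by simp
qed

lemma unramified_sliding_block_code: "unramified Y X \<pi> \<Longrightarrow> sliding_block_code Y X \<pi>"
  by (simp add: unramified_def factor_map_def)

lemma unramified_image: "unramified Y X \<pi> \<Longrightarrow> \<pi> ` Y = X"
  by (simp add: unramified_def factor_map_def)

text \<open>Freeness of the action: \<open>g\<close> and \<open>h\<close> are two lifts of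
  \<open>\<pi>\<close> through itself, so rigidity turns agreement at \<open>y\<close> into
  equality.\<close>

lemma Aut_over_evaluation_inj:
  assumes "irreducible_SFT Y" "unramified Y X \<pi>" "y \<in> Y"
  shows "inj_on (\<lambda>g. g y) (Aut_over Y \<pi>)"
proof (rule inj_onI)
  fix g h assume g: "g \<in> Aut_over Y \<pi>" and h: "h \<in> Aut_over Y \<pi>" and eq: "g y = h y"
  note gD = Aut_overD[OF g] and hD = Aut_overD[OF h]
  have "SFT Y"
    using assms(1) by (simp add: irreducible_SFT_def)
  then have "g y' = h y'" if "y' \<in> Y" for y'
    by (rule sliding_block_code_lift_unique[OF assms(1) _ gD(2) hD(2)
          unramified_sliding_block_code[OF assms(2)] unramified_finite_fiber[OF assms(2)]
          _ assms(3) eq that])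
      (simp add: gD hD)
  then show "g = h"
    using gD(1) hD(1) by (rule extensionalityI[rotated 2])
qed

text \<open>By freeness the group has as many elements as each of its orbits. An orbit lies in a
  finite fiber with \<open>factor_degree Y X \<pi>\<close> elements, so it fills the fiber exactly
  when the two cardinalities agree.\<close>

lemma galois_factor_iff_transitive:
  assumes "irreducible_SFT Y" "unramified Y X \<pi>"
  shows "galois_factor Y X \<pi> \<longleftrightarrow>
    (\<forall>y\<in>Y. \<forall>y'\<in>Y. \<pi> y = \<pi> y' \<longrightarrow> (\<exists>g\<in>Aut_over Y \<pi>. g y = y'))"
proof -
  have sub: "(\<lambda>g. g y) ` Aut_over Y \<pi> \<subseteq> fiber Y \<pi> (\<pi> y)" if "y \<in> Y" for y
    by (auto simp: fiber_def dest: Aut_overD(4)[OF _ that] Aut_overD(5)[OF _ that])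
  have card: "card (fiber Y \<pi> (\<pi> y)) = factor_degree Y X \<pi>" if "y \<in> Y" for y
    using that unramified_image[OF assms(2)] by (intro unramified_card_fiber[OF assms(2)]) auto
  have card_img: "card ((\<lambda>g. g y) ` Aut_over Y \<pi>) = card (Aut_over Y \<pi>)" if "y \<in> Y" for y
    using Aut_over_evaluation_inj[OF assms that] by (rule card_image)
  have img_iff: "(\<lambda>g. g y) ` Aut_over Y \<pi> = fiber Y \<pi> (\<pi> y) \<longleftrightarrow>
      card (Aut_over Y \<pi>) = factor_degree Y X \<pi>" if "y \<in> Y" for y
    using card_subset_eq[OF unramified_finite_fiber[OF assms(2)] sub[OF that]]
      card[OF that] card_img[OF that] by metis
  \<comment> \<open>The cardinality condition mentions no point; recovering it from the orbit
    condition takes at least one point of \<open>Y\<close>.\<close>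
  obtain y\<^sub>0 where "y\<^sub>0 \<in> Y"
    using assms(1) by (auto simp: irreducible_SFT_def SFT_def shift_space_def)
  have "galois_factor Y X \<pi> \<longleftrightarrow> card (Aut_over Y \<pi>) = factor_degree Y X \<pi>"
    using assms(2) by (simp add: galois_factor_def)
  also have "\<dots> \<longleftrightarrow> (\<forall>y\<in>Y. (\<lambda>g. g y) ` Aut_over Y \<pi> = fiber Y \<pi> (\<pi> y))"
    using \<open>y\<^sub>0 \<in> Y\<close> by (auto simp: img_iff)
  also have "\<dots> \<longleftrightarrow> (\<forall>y\<in>Y. fiber Y \<pi> (\<pi> y) \<subseteq> (\<lambda>g. g y) ` Aut_over Y \<pi>)"
    using sub by (intro ball_cong refl) (simp add: set_eq_subset)
  also have "\<dots> \<longleftrightarrow> (\<forall>y\<in>Y. \<forall>y'\<in>Y. \<pi> y = \<pi> y' \<longrightarrow> (\<exists>g\<in>Aut_over Y \<pi>. g y = y'))"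
    by (simp add: fiber_def subset_iff image_iff eq_commute) blast
  finally show ?thesis .
qed

text \<open>Multiplicativity of degrees: a fiber of \<open>\<pi>\<close> is the disjoint union of
  the fibers of \<open>\<alpha>\<close> over a fiber of \<open>\<beta>\<close>, so the latter has
  constant size \<open>d div e\<close>.\<close>

lemma unramified_intermediate:
  assumes \<pi>: "unramified Y X \<pi>" and "intermediate_factor Y X \<pi> Z \<alpha> \<beta>"
  shows "unramified Z X \<beta>"
proof -
  have \<alpha>: "unramified Y Z \<alpha>" and \<beta>: "sliding_block_code Z X \<beta>"
    and comp: "\<And>y. y \<in> Y \<Longrightarrow> \<beta> (\<alpha> y) = \<pi> y"
    using assms(2) by (auto simp: intermediate_factor_def)
  have "\<beta> ` Z = (\<lambda>y. \<beta> (\<alpha> y)) ` Y"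
    by (simp add: image_image flip: unramified_image[OF \<alpha>])
  also have "\<dots> = X"
    using comp by (simp flip: unramified_image[OF \<pi>])
  finally have "\<beta> ` Z = X" .
  then have fac: "factor_map Z X \<beta>"
    using \<beta> by (simp add: factor_map_def)
  have img: "\<alpha> ` fiber Y \<pi> x = fiber Z \<beta> x" for x
    unfolding fiber_def unramified_image[OF \<alpha>, symmetric] using comp by auto
  have fin: "finite (fiber Z \<beta> x)" for x
    unfolding img[symmetric] by (intro finite_imageI unramified_finite_fiber[OF \<pi>])
  define e where "e = factor_degree Y Z \<alpha>"
  have count: "card (fiber Y \<pi> x) = e * card (fiber Z \<beta> x)" for x
  proof -
    have "fiber Y \<pi> x = (\<Union>z\<in>fiber Z \<beta> x. fiber Y \<alpha> z)"
      using unramified_image[OF \<alpha>] comp[symmetric] by (auto simp: fiber_def)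
    also have "card \<dots> = (\<Sum>z\<in>fiber Z \<beta> x. card (fiber Y \<alpha> z))"
      using fin unramified_finite_fiber[OF \<alpha>]
      by (intro card_UN_disjoint) (auto simp: fiber_def)
    also have "\<dots> = (\<Sum>z\<in>fiber Z \<beta> x. e)"
      by (intro sum.cong refl) (auto simp: e_def fiber_def intro: unramified_card_fiber[OF \<alpha>, unfolded fiber_def])
    finally show ?thesis by simp
  qed
  define d where "d = factor_degree Y X \<pi>"
  have pos: "card (fiber Y \<pi> x) \<ge> 1" if "x \<in> X" for x
    using \<pi> that by (auto simp: unramified_def)
  show ?thesis
  proof (cases "X = {}")
    case True
    then show ?thesis using fac by (auto simp: unramified_def)
  next
    case False
    then obtain x\<^sub>0 where x\<^sub>0: "x\<^sub>0 \<in> X" by blast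
    have e: "e > 0"
      using count[of x\<^sub>0] pos[OF x\<^sub>0] by (cases e) auto
    have "card (fiber Z \<beta> x) = d div e" if "x \<in> X" for x
      using count[of x] e unramified_card_fiber[OF \<pi> that] by (simp add: d_def)
    moreover have "d div e \<ge> 1"
      using calculation[OF x\<^sub>0] count[of x\<^sub>0] pos[OF x\<^sub>0] by (cases "d div e") auto
    ultimately show ?thesis
      using fac unfolding unramified_def by blast
  qed
qed

section \<open>Descending automorphisms to an intermediate factor\<close>

text \<open>A relation rather than an induced map, because \<open>g\<close> need not respect the
  fibers of \<open>\<alpha>\<close>; whether a suitable \<open>\<psi>\<close> exists is the
  question.\<close>

definition descends ::
  "'b biseq set \<Rightarrow> ('b biseq \<Rightarrow> 'c biseq) \<Rightarrow> ('b biseq \<Rightarrow> 'b biseq) \<Rightarrow> ('c biseq \<Rightarrow> 'c biseq) \<Rightarrow> bool"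
  where "descends Y \<alpha> g \<psi> \<longleftrightarrow> (\<forall>y\<in>Y. \<psi> (\<alpha> y) = \<alpha> (g y))"

theorem theorem4p6:
  fixes X :: "('a::{finite,discrete_topology}) biseq set"
    and Y :: "('b::{finite,discrete_topology}) biseq set"
    and Z :: "('c::{finite,discrete_topology}) biseq set"
    and \<pi> :: "'b biseq \<Rightarrow> 'a biseq"
    and \<alpha> :: "'b biseq \<Rightarrow> 'c biseq"
    and \<beta> :: "'c biseq \<Rightarrow> 'a biseq"
    and H :: "('b biseq \<Rightarrow> 'b biseq) set"
  assumes "irreducible_SFT X"
    and "irreducible_SFT Y"
    and "galois_factor Y X \<pi>"
    and "subgroup H (Gal Y \<pi>)"
    and "corresponding_intermediate_factor Y X \<pi> H Z \<alpha> \<beta>"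
  shows "(H \<lhd> Gal Y \<pi> \<longleftrightarrow> galois_factor Z X \<beta>) \<and>
         (H \<lhd> Gal Y \<pi> \<longrightarrow> Gal Z \<beta> \<cong> Gal Y \<pi> Mod H)"
proof -
  let ?G = "Aut_over Y \<pi>" and ?K = "Aut_over Z \<beta>"
  have inter: "intermediate_factor Y X \<pi> Z \<alpha> \<beta>"
    and galH: "galois_factor Y Z \<alpha>" and H: "H = Aut_over Y \<alpha>"
    using assms(5) by (auto simp: corresponding_intermediate_factor_def)
  have Z: "irreducible_SFT Z" "SFT Z" and \<alpha>: "unramified Y Z \<alpha>" and \<beta>: "sliding_block_code Z X \<beta>"
    and comp: "\<And>y. y \<in> Y \<Longrightarrow> \<beta> (\<alpha> y) = \<pi> y"
    using inter by (auto simp: intermediate_factor_def irreducible_SFT_def)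
  have \<pi>: "unramified Y X \<pi>"
    using assms(3) by (simp add: galois_factor_def)
  note \<beta>un = unramified_intermediate[OF \<pi> inter]
  have ssY: "shift_space Y" and ssZ: "shift_space Z"
    using assms(2) Z by (auto simp: irreducible_SFT_def SFT_def)
  note \<alpha>code = unramified_sliding_block_code[OF \<alpha>] and \<alpha>img = unramified_image[OF \<alpha>]
  have \<alpha>Z: "\<alpha> y \<in> Z" if "y \<in> Y" for y
    using that \<alpha>img by blast
  have transG: "\<exists>g\<in>?G. g y = y'" if "y \<in> Y" "y' \<in> Y" "\<pi> y = \<pi> y'" for y y'
    using galois_factor_iff_transitive[OF assms(2) \<pi>] assms(3) that by blast
  have transH: "\<exists>h\<in>H. h y = y'" if "y \<in> Y" "y' \<in> Y" "\<alpha> y = \<alpha> y'" for y y'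
    using galois_factor_iff_transitive[OF assms(2) \<alpha>] galH that unfolding H by blast
  interpret G: group "Gal Y \<pi>" by (rule group_Gal[OF ssY])
  interpret K: group "Gal Z \<beta>" by (rule group_Gal[OF ssZ])
  have HG: "H \<subseteq> ?G"
    using subgroup.subset[OF assms(4)] by simp
  have inv_in: "inv\<^bsub>Gal Y \<pi>\<^esub> g \<in> ?G" if "g \<in> ?G" for g
    using G.inv_closed that by simp
  have inv_right: "g ((inv\<^bsub>Gal Y \<pi>\<^esub> g) y) = y" if "g \<in> ?G" "y \<in> Y" for g y
    using fun_cong[of _ _ y, OF G.r_inv[of g]] that inv_in
    by (simp add: Gal_mult Gal_one compose_def)
  \<comment> \<open>Rigidity for the two codes \<open>\<psi>\<close> after \<open>\<alpha>\<close>
    and \<open>\<alpha>\<close> after \<open>g\<close> from \<open>Y\<close> to \<open>Z\<close>: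
    both lie over \<open>\<pi>\<close>, so commutation at one point suffices.\<close>
  have descends_unique: "descends Y \<alpha> g \<psi>"
    if g: "g \<in> ?G" and \<psi>: "\<psi> \<in> ?K" and y: "y \<in> Y" "\<psi> (\<alpha> y) = \<alpha> (g y)" for g \<psi> y
    unfolding descends_def
  proof
    fix y' assume "y' \<in> Y"
    note gD = Aut_overD[OF g] and \<psi>D = Aut_overD[OF \<psi>]
    show "\<psi> (\<alpha> y') = \<alpha> (g y')"
      by (rule sliding_block_code_lift_unique[OF assms(2) Z(2)
            sliding_block_code_comp[OF \<alpha>code \<psi>D(2)] sliding_block_code_comp[OF gD(2) \<alpha>code]
            \<beta> unramified_finite_fiber[OF \<beta>un] _ y \<open>y' \<in> Y\<close>])
        (simp add: gD \<psi>D \<alpha>Z comp)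
  qed
  \<comment> \<open>A preimage \<open>y'\<close> of \<open>\<psi> (\<alpha> y)\<close> lies in the
    same fiber of \<open>\<pi>\<close> as \<open>y\<close>. The element of \<open>?G\<close> taking
    \<open>y\<close> to \<open>y'\<close> matches \<open>\<psi>\<close> at one point, hence
    everywhere.\<close>
  have ex_descends: "\<exists>g\<in>?G. descends Y \<alpha> g \<psi>" if \<psi>: "\<psi> \<in> ?K" for \<psi>
  proof -
    obtain y where y: "y \<in> Y"
      using ssY by (auto simp: shift_space_def)
    obtain y' where y': "y' \<in> Y" "\<alpha> y' = \<psi> (\<alpha> y)"
      using Aut_overD(4)[OF \<psi> \<alpha>Z[OF y]] \<alpha>img by (metis imageE)
    then have "\<pi> y = \<pi> y'"
      using comp y Aut_overD(5)[OF \<psi> \<alpha>Z[OF y]] by metis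
    then obtain g where "g \<in> ?G" "g y = y'"
      using transG y y' by blast
    with \<psi> y y' show ?thesis
      by (metis descends_unique)
  qed
  define D where "D \<longleftrightarrow> (\<forall>g\<in>?G. \<exists>\<psi>\<in>?K. descends Y \<alpha> g \<psi>)"

  \<comment> \<open>The Galois property of \<open>\<beta>\<close> in terms of descent\<close>
  have galois_iff: "galois_factor Z X \<beta> \<longleftrightarrow> D"
  proof
    assume "galois_factor Z X \<beta>"
    then have transK: "\<exists>\<psi>\<in>?K. \<psi> z = z'" if "z \<in> Z" "z' \<in> Z" "\<beta> z = \<beta> z'" for z z'
      using galois_factor_iff_transitive[OF Z(1) \<beta>un] that by blast
    obtain y where y: "y \<in> Y"
      using ssY by (auto simp: shift_space_def)
    show D
      unfolding D_def
    proof
      fix g assume g: "g \<in> ?G"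
      then obtain \<psi> where "\<psi> \<in> ?K" "\<psi> (\<alpha> y) = \<alpha> (g y)"
        using transK[of "\<alpha> y" "\<alpha> (g y)"] \<alpha>Z comp y Aut_overD(4,5)[OF g y] by auto
      then show "\<exists>\<psi>\<in>?K. descends Y \<alpha> g \<psi>"
        using descends_unique g y by blast
    qed
  next
    assume D
    have "\<exists>\<psi>\<in>?K. \<psi> z = z'" if "z \<in> Z" "z' \<in> Z" "\<beta> z = \<beta> z'" for z z'
    proof -
      obtain y y' where y: "y \<in> Y" "y' \<in> Y" "z = \<alpha> y" "z' = \<alpha> y'"
        using \<open>z \<in> Z\<close> \<open>z' \<in> Z\<close> \<alpha>img by blast
      then obtain g where "g \<in> ?G" "g y = y'"
        using transG \<open>\<beta> z = \<beta> z'\<close> comp by metis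
      then show ?thesis
        using \<open>D\<close> y unfolding D_def descends_def by metis
    qed
    then show "galois_factor Z X \<beta>"
      using galois_factor_iff_transitive[OF Z(1) \<beta>un] by blast
  qed

  \<comment> \<open>Normality of \<open>H\<close> in terms of descent\<close>
  have normal_iff: "H \<lhd> Gal Y \<pi> \<longleftrightarrow> D"
  proof
    assume normal: "H \<lhd> Gal Y \<pi>"
    \<comment> \<open>The fibers of \<open>\<alpha>\<close> are the orbits of \<open>H\<close>, so
      \<open>y' = h y\<close>. Normality rewrites \<open>g\<close> after \<open>h\<close> as
      \<open>h'\<close> after \<open>g\<close>, and \<open>h'\<close> in \<open>H\<close> is
      invisible to \<open>\<alpha>\<close>.\<close>
    have resp: "\<alpha> (g y) = \<alpha> (g y')"
      if g: "g \<in> ?G" and y: "y \<in> Y" "y' \<in> Y" "\<alpha> y = \<alpha> y'" for g y y'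
    proof -
      obtain h where h: "h \<in> H" "h y = y'"
        using transH y by blast
      have "g \<otimes>\<^bsub>Gal Y \<pi>\<^esub> h \<in> H #>\<^bsub>Gal Y \<pi>\<^esub> g"
        using normal.coset_eq[OF normal] g h(1) unfolding l_coset_def r_coset_def by fastforce
      then obtain h' where h': "h' \<in> H" "g \<otimes>\<^bsub>Gal Y \<pi>\<^esub> h = h' \<otimes>\<^bsub>Gal Y \<pi>\<^esub> g"
        by (auto simp: r_coset_def)
      then have "compose Y g h = compose Y h' g"
        using g h(1) HG by (metis Gal_mult subsetD)
      then have "g y' = h' (g y)"
        using fun_cong[of _ _ y] y(1) h(2) by (metis compose_eq)
      then show ?thesis
        using Aut_overD(5)[of h' Y \<alpha> "g y"] h'(1) Aut_overD(4)[OF g y(1)] by (simp add: H)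
    qed
    \<comment> \<open>The descended map uses an arbitrary preimage under \<open>\<alpha>\<close>;
      \<open>resp\<close> makes the choice irrelevant.\<close>
    define \<Psi> where "\<Psi> g = (\<lambda>z\<in>Z. \<alpha> (g (inv_into Y \<alpha> z)))" for g
    have \<Psi>: "\<Psi> g (\<alpha> y) = \<alpha> (g y)" if "g \<in> ?G" "y \<in> Y" for g y
    proof -
      have "inv_into Y \<alpha> (\<alpha> y) \<in> Y" "\<alpha> (inv_into Y \<alpha> (\<alpha> y)) = \<alpha> y"
        using that(2) by (simp_all add: inv_into_into f_inv_into_f)
      then have "\<alpha> (g (inv_into Y \<alpha> (\<alpha> y))) = \<alpha> (g y)"
        using resp that by blast
      then show ?thesis
        using \<alpha>Z[OF that(2)] by (simp add: \<Psi>_def)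
    qed
    have "\<Psi> g \<in> ?K" if g: "g \<in> ?G" for g
    proof (rule Aut_overI)
      note gD = Aut_overD[OF g]
      show "\<Psi> g \<in> extensional Z"
        by (simp add: \<Psi>_def)
      have "sliding_block_code Y Z (\<lambda>y. \<Psi> g (\<alpha> y))"
        by (rule sliding_block_code_cong[OF sliding_block_code_comp[OF gD(2) \<alpha>code]])
          (use \<Psi>[OF g] ssY in \<open>simp_all add: shift_space_def\<close>)
      then show "sliding_block_code Z Z (\<Psi> g)"
        by (rule sliding_block_code_descend[where g = "\<Psi> g", OF ssY \<alpha>code \<alpha>img])
      show "\<beta> (\<Psi> g z) = \<beta> z" if "z \<in> Z" for z
        using that \<alpha>img \<Psi>[OF g] comp gD by auto
      \<comment> \<open>Stated for a fresh \<open>g\<close>, so that it applies both to the given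
        element and to its inverse and gives a two-sided inverse of \<open>\<Psi> g\<close>.\<close>
      have cancel: "\<Psi> g (\<Psi> (inv\<^bsub>Gal Y \<pi>\<^esub> g) z) = z" if "z \<in> Z" and g: "g \<in> ?G" for z g
      proof -
        obtain y where "y \<in> Y" "z = \<alpha> y"
          using \<open>z \<in> Z\<close> \<alpha>img by blast
        then show ?thesis
          using \<Psi> g inv_in[OF g] Aut_overD(4)[OF inv_in[OF g]] inv_right[OF g] by simp
      qed
      have into: "\<Psi> g z \<in> Z" if "z \<in> Z" "g \<in> ?G" for z g
      proof -
        obtain y where "y \<in> Y" "z = \<alpha> y"
          using \<open>z \<in> Z\<close> \<alpha>img by blast
        then show ?thesis
          using \<Psi>[OF \<open>g \<in> ?G\<close>] \<alpha>Z Aut_overD(4)[OF \<open>g \<in> ?G\<close>] by simp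
      qed
      have "inv\<^bsub>Gal Y \<pi>\<^esub> (inv\<^bsub>Gal Y \<pi>\<^esub> g) = g"
        using G.inv_inv g by simp
      then show "bij_betw (\<Psi> g) Z Z"
        using cancel[OF _ g] cancel[OF _ inv_in[OF g]] into[OF _ g] into[OF _ inv_in[OF g]]
        by (intro bij_betw_byWitness[where f' = "\<Psi> (inv\<^bsub>Gal Y \<pi>\<^esub> g)"]) auto
    qed
    then show D
      using \<Psi> unfolding D_def descends_def by blast
  next
    assume D
    show "H \<lhd> Gal Y \<pi>"
    proof (rule G.normal_invI[OF assms(4)])
      fix g h assume "g \<in> carrier (Gal Y \<pi>)" and h: "h \<in> H"
      then have g: "g \<in> ?G" and hG: "h \<in> ?G" using HG by auto
      let ?i = "inv\<^bsub>Gal Y \<pi>\<^esub> g"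
      let ?c = "g \<otimes>\<^bsub>Gal Y \<pi>\<^esub> h \<otimes>\<^bsub>Gal Y \<pi>\<^esub> ?i"
      have gh: "g \<otimes>\<^bsub>Gal Y \<pi>\<^esub> h \<in> ?G" and c: "?c \<in> ?G"
        using G.m_closed inv_in[OF g] g hG by simp_all
      obtain \<psi> where \<psi>: "\<psi> \<in> ?K" "descends Y \<alpha> g \<psi>"
        using \<open>D\<close> g unfolding D_def by blast
      \<comment> \<open>Passing \<open>\<alpha>\<close> through \<open>g\<close> turns it into
        \<open>\<psi>\<close>, after which \<open>h\<close> disappears because it preserves
        \<open>\<alpha>\<close>; then \<open>g\<close> cancels its inverse.\<close>
      have "\<alpha> (?c y) = \<alpha> y" if y: "y \<in> Y" for y
      proof -
        have iy: "?i y \<in> Y"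
          using Aut_overD(4)[OF inv_in[OF g] y] .
        have "?c y = g (h (?i y))"
          using Gal_mult[OF gh inv_in[OF g]] Gal_mult[OF g hG] y iy by (simp add: compose_def)
        then have "\<alpha> (?c y) = \<psi> (\<alpha> (h (?i y)))"
          using \<psi>(2) Aut_overD(4)[OF hG iy] by (simp add: descends_def)
        also have "\<dots> = \<psi> (\<alpha> (?i y))"
          using Aut_overD(5)[of h Y \<alpha>] h iy by (simp add: H)
        also have "\<dots> = \<alpha> y"
          using \<psi>(2) iy inv_right[OF g y] by (simp add: descends_def)
        finally show ?thesis .
      qed
      then show "?c \<in> H"
        using Aut_overD[OF c] unfolding H by (intro Aut_overI)
    qed
  qed

  \<comment> \<open>The Galois group of \<open>\<beta>\<close> by the first isomorphism
    theorem\<close>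
  have "Gal Z \<beta> \<cong> Gal Y \<pi> Mod H" if normal: "H \<lhd> Gal Y \<pi>"
  proof -
    have D using normal normal_iff by simp
    then obtain \<Phi> where \<Phi>: "\<And>g. g \<in> ?G \<Longrightarrow> \<Phi> g \<in> ?K" "\<And>g. g \<in> ?G \<Longrightarrow> descends Y \<alpha> g (\<Phi> g)"
      unfolding D_def by metis
    have \<Phi>eq: "\<Phi> g (\<alpha> y) = \<alpha> (g y)" if "g \<in> ?G" "y \<in> Y" for g y
      using \<Phi>(2) that by (simp add: descends_def)
    \<comment> \<open>Since \<open>\<alpha>\<close> is onto \<open>Z\<close> and elements of
      \<open>?K\<close> are extensional, precomposition with \<open>\<alpha>\<close> determines
      them. So the choice of \<open>\<Phi>\<close> is forced, and identities in \<open>?K\<close>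
      can be checked on points \<open>\<alpha> y\<close>.\<close>
    have unique: "\<psi> = \<psi>'" if "\<psi> \<in> ?K" "\<psi>' \<in> ?K" "\<And>y. y \<in> Y \<Longrightarrow> \<psi> (\<alpha> y) = \<psi>' (\<alpha> y)" for \<psi> \<psi>'
      using Aut_overD(1)[OF that(1)] Aut_overD(1)[OF that(2)]
      by (rule extensionalityI) (use that(3) \<alpha>img in blast)
    have hom: "\<Phi> \<in> hom (Gal Y \<pi>) (Gal Z \<beta>)"
    proof (rule homI)
      fix g h assume "g \<in> carrier (Gal Y \<pi>)" "h \<in> carrier (Gal Y \<pi>)"
      then have g: "g \<in> ?G" and h: "h \<in> ?G" by auto
      have gh: "g \<otimes>\<^bsub>Gal Y \<pi>\<^esub> h \<in> ?G" "\<Phi> g \<otimes>\<^bsub>Gal Z \<beta>\<^esub> \<Phi> h \<in> ?K"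
        using G.m_closed K.m_closed g h \<Phi>(1) by simp_all
      show "\<Phi> (g \<otimes>\<^bsub>Gal Y \<pi>\<^esub> h) = \<Phi> g \<otimes>\<^bsub>Gal Z \<beta>\<^esub> \<Phi> h"
      proof (rule unique[OF \<Phi>(1)[OF gh(1)] gh(2)])
        fix y assume y: "y \<in> Y"
        show "\<Phi> (g \<otimes>\<^bsub>Gal Y \<pi>\<^esub> h) (\<alpha> y) = (\<Phi> g \<otimes>\<^bsub>Gal Z \<beta>\<^esub> \<Phi> h) (\<alpha> y)"
        proof -
          have "\<Phi> (g \<otimes>\<^bsub>Gal Y \<pi>\<^esub> h) (\<alpha> y) = \<alpha> ((g \<otimes>\<^bsub>Gal Y \<pi>\<^esub> h) y)"
            using gh(1) y by (rule \<Phi>eq)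
          also have "\<dots> = \<alpha> (g (h y))"
            by (simp add: Gal_mult[OF g h] compose_eq[OF y])
          also have "\<dots> = \<Phi> g (\<Phi> h (\<alpha> y))"
            by (simp add: \<Phi>eq[OF g] \<Phi>eq[OF h] y Aut_overD(4)[OF h])
          also have "\<dots> = (\<Phi> g \<otimes>\<^bsub>Gal Z \<beta>\<^esub> \<Phi> h) (\<alpha> y)"
            by (simp add: Gal_mult[OF \<Phi>(1)[OF g] \<Phi>(1)[OF h]] compose_eq \<alpha>Z y)
          finally show ?thesis .
        qed
      qed
    qed (simp add: \<Phi>(1))
    interpret \<Phi>: group_hom "Gal Y \<pi>" "Gal Z \<beta>" \<Phi>
      by unfold_locales (rule hom)
    have "\<Phi> ` carrier (Gal Y \<pi>) = carrier (Gal Z \<beta>)"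
    proof -
      have "\<psi> \<in> \<Phi> ` ?G" if \<psi>: "\<psi> \<in> ?K" for \<psi>
      proof -
        obtain g where g: "g \<in> ?G" "descends Y \<alpha> g \<psi>"
          using ex_descends[OF \<psi>] by blast
        then have "\<psi> = \<Phi> g"
          using \<psi> \<Phi> by (intro unique) (auto simp: descends_def)
        with g(1) show ?thesis by blast
      qed
      then show ?thesis using \<Phi>(1) by auto
    qed
    then have "Gal Y \<pi> Mod kernel (Gal Y \<pi>) (Gal Z \<beta>) \<Phi> \<cong> Gal Z \<beta>"
      by (rule \<Phi>.FactGroup_iso)
    moreover have "kernel (Gal Y \<pi>) (Gal Z \<beta>) \<Phi> = H"
    proof -
      have "\<Phi> g = \<one>\<^bsub>Gal Z \<beta>\<^esub> \<longleftrightarrow> g \<in> H" if g: "g \<in> ?G" for g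
      proof
        assume "\<Phi> g = \<one>\<^bsub>Gal Z \<beta>\<^esub>"
        then have "\<alpha> (g y) = \<alpha> y" if "y \<in> Y" for y
          using \<Phi>eq[OF g that] \<alpha>Z[OF that] by (simp add: Gal_one)
        then show "g \<in> H"
          using Aut_overD[OF g] unfolding H by (intro Aut_overI)
      next
        assume "g \<in> H"
        moreover have "\<one>\<^bsub>Gal Z \<beta>\<^esub> \<in> ?K"
          using K.one_closed by simp
        ultimately show "\<Phi> g = \<one>\<^bsub>Gal Z \<beta>\<^esub>"
          using \<Phi>(1)[OF g] \<Phi>eq[OF g] \<alpha>Z Aut_overD(5)[of g Y \<alpha>]
          by (intro unique) (simp_all add: Gal_one H)
      qed
      then show ?thesis
        using HG by (auto simp: kernel_def)
    qed
    ultimately show ?thesis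
      \<comment> \<open>The first isomorphism theorem gives the isomorphism starting from the
        quotient; the claim has the reverse direction.\<close>
      using group.iso_sym[OF normal.factorgroup_is_group[OF normal]] by simp
  qed
  then show ?thesis
    using galois_iff normal_iff by blast
qed

end
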